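(* Let $n\ge 1$, let $\mathbf m=(m_1,\dots,m_n)$ and $\mathbf M=(M_1,\dots,M_n)$ be vectors of $\mathbb R^n$ with components arranged in nonincreasing order, $0\le m_i\le M_i$ for all $i$, and let $a>0$ with $\sum_{i=1}^n m_i\le a\le\sum_{i=1}^n M_i$. Let $$S_a=\Big\{\mathbf x\in\mathbb R^n:\ x_1\ge\dots\ge x_n\ge 0,\ \sum_{i=1}^n x_i=a,\ m_i\le x_i\le M_i \text{ for } i=1,\dots,n\Big\}.$$ Let $k\ge0$ and $d\ge0$ be the smallest integers such that (1) $k+d<n$, and (2) $m_{k+1}\le\rho\le M_{n-d}$, where $$\rho=\frac{a-\sum_{i=1}^k m_i-\sum_{i=n-d+1}^n M_i}{n-k-d}.$$ Then the minimal element of $S_a$ with respect to the majorization order is $$\mathbf x_*(S_a)=(m_1,\dots,m_k,\ \underbrace{\rho,\dots,\rho}_{n-k-d},\ M_{n-d+1},\dots,M_n),$$ i.e. this vector belongs to $S_a$ and $\mathbf x_*(S_a)\trianglelefteq\mathbf x$ for every $\mathbf x\in S_a$.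
   Context: For vectors $\mathbf x,\mathbf y\in\mathbb R^n$ with components arranged in nonincreasing order, $\mathbf x\trianglelefteq\mathbf y$ (majorization) means $\sum_{i=1}^j x_i\le\sum_{i=1}^j y_i$ for $j=1,\dots,n-1$ and $\sum_{i=1}^n x_i=\sum_{i=1}^n y_i$. The minimal element $\mathbf x_*(S)$ of a set $S$ is the element of $S$ with $\mathbf x_*(S)\trianglelefteq\mathbf x$ for all $\mathbf x\in S$. Empty sums are $0$. *)

theory Defs
  imports Complex_Main "HOL-Library.FuncSet"
begin

text \<open>A vector of \<open>\<real>\<^sup>n\<close> is a function \<open>nat \<Rightarrow> real\<close> whose components are its
  values on \<open>{1..n}\<close>.\<close>

text \<open>This is the majorization order only between vectors whose components are arranged in
  nonincreasing order; no rearrangement is performed.\<close>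

definition majorized :: "nat \<Rightarrow> (nat \<Rightarrow> real) \<Rightarrow> (nat \<Rightarrow> real) \<Rightarrow> bool" where
  "majorized n x y \<longleftrightarrow>
     (\<forall>j\<in>{1..n - 1}. (\<Sum>i=1..j. x i) \<le> (\<Sum>i=1..j. y i)) \<and>
     (\<Sum>i=1..n. x i) = (\<Sum>i=1..n. y i)"

definition minimal_element :: "nat \<Rightarrow> (nat \<Rightarrow> real) set \<Rightarrow> (nat \<Rightarrow> real) \<Rightarrow> bool" where
  "minimal_element n S x \<longleftrightarrow> x \<in> S \<and> (\<forall>y\<in>S. majorized n x y)"

text \<open>Extensionality makes the elements of the set correspond one-to-one to vectors of
  \<open>\<real>\<^sup>n\<close>, so that a minimal element is unique.\<close>

definition S_set :: "nat \<Rightarrow> (nat \<Rightarrow> real) \<Rightarrow> (nat \<Rightarrow> real) \<Rightarrow> real \<Rightarrow> (nat \<Rightarrow> real) set" where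
  "S_set n m M a =
     {x \<in> extensional {1..n}. antimono_on {1..n} x \<and> 0 \<le> x n \<and>
        (\<Sum>i=1..n. x i) = a \<and> (\<forall>i\<in>{1..n}. m i \<le> x i \<and> x i \<le> M i)}"

definition rho :: "nat \<Rightarrow> (nat \<Rightarrow> real) \<Rightarrow> (nat \<Rightarrow> real) \<Rightarrow> real \<Rightarrow> nat \<Rightarrow> nat \<Rightarrow> real" where
  "rho n m M a k d =
     (a - (\<Sum>i=1..k. m i) - (\<Sum>i=n - d + 1..n. M i)) / (real n - real k - real d)"

definition admissible :: "nat \<Rightarrow> (nat \<Rightarrow> real) \<Rightarrow> (nat \<Rightarrow> real) \<Rightarrow> real \<Rightarrow> nat \<Rightarrow> nat \<Rightarrow> bool" where
  "admissible n m M a k d \<longleftrightarrow>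
     k + d < n \<and> m (k + 1) \<le> rho n m M a k d \<and> rho n m M a k d \<le> M (n - d)"

text \<open>\<open>Smallest\<close> means minimal in the componentwise order on pairs. A componentwise least
  admissible pair need not exist: for \<open>n = 2\<close>, \<open>m = (3, 0)\<close>, \<open>M = (4, 1)\<close>, \<open>a = 4\<close> the
  admissible pairs are \<open>(1, 0)\<close> and \<open>(0, 1)\<close>. When a least pair exists it is the only
  minimal one; a pair that is lexicographically least, or has least sum, is always minimal.\<close>

definition smallest_admissible ::
  "nat \<Rightarrow> (nat \<Rightarrow> real) \<Rightarrow> (nat \<Rightarrow> real) \<Rightarrow> real \<Rightarrow> nat \<Rightarrow> nat \<Rightarrow> bool" where
  "smallest_admissible n m M a k d \<longleftrightarrow>
     admissible n m M a k d \<and>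
     (\<forall>k' d'. admissible n m M a k' d' \<and> k' \<le> k \<and> d' \<le> d \<longrightarrow> k' = k \<and> d' = d)"

definition x_star ::
  "nat \<Rightarrow> (nat \<Rightarrow> real) \<Rightarrow> (nat \<Rightarrow> real) \<Rightarrow> real \<Rightarrow> nat \<Rightarrow> nat \<Rightarrow> (nat \<Rightarrow> real)" where
  "x_star n m M a k d =
     (\<lambda>i\<in>{1..n}. if i \<le> k then m i else if i \<le> n - d then rho n m M a k d else M i)"

end

theory Submission
  imports Defs
begin

text \<open>The minimiser truncates a constant level \<open>\<lambda>\<close>: \<open>x i = max (m i) (min \<lambda> (M i))\<close>.
  The intermediate value theorem gives a level at which the components sum to \<open>a\<close>; counting
  the components with \<open>m i > \<lambda>\<close> and those with \<open>M i < \<lambda>\<close> gives an admissible pair. Conversely,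
  minimality of an admissible pair forces \<open>m k \<ge> \<rho> \<ge> M (n - d + 1)\<close>, since otherwise one
  index could be dropped; hence \<open>x_star\<close> is the truncation at level \<open>\<rho>\<close>. Compared with a
  decreasing vector \<open>y\<close> between \<open>m\<close> and \<open>M\<close>, the truncation lies below \<open>y\<close> on \<open>{1..j}\<close> or above
  \<open>y\<close> on \<open>{j+1..n}\<close>, for every \<open>j\<close>, and either alternative gives the partial sum inequality.\<close>

text \<open>When \<open>m i \<le> M i\<close>, this is the point of the interval from
  \<open>m i\<close> to \<open>M i\<close> nearest to \<open>c\<close>.\<close>

definition trunc_level :: "(nat \<Rightarrow> real) \<Rightarrow> (nat \<Rightarrow> real) \<Rightarrow> real \<Rightarrow> nat \<Rightarrow> real" where
  "trunc_level m M c i = max (m i) (min c (M i))"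

section \<open>Block sums and the equation for \<open>rho\<close>\<close>

lemma sum_split3:
  fixes f :: "nat \<Rightarrow> real"
  assumes "k + d \<le> n"
  shows "(\<Sum>i=1..n. f i) = (\<Sum>i=1..k. f i) + (\<Sum>i=k+1..n-d. f i) + (\<Sum>i=n-d+1..n. f i)"
proof -
  have "(\<Sum>i=1..n. f i) = (\<Sum>i=1..n-d. f i) + (\<Sum>i=n-d+1..n. f i)"
    using sum.ub_add_nat[of 1 "n - d" f d] assms by simp
  moreover have "(\<Sum>i=1..n-d. f i) = (\<Sum>i=1..k. f i) + (\<Sum>i=k+1..n-d. f i)"
    using sum.ub_add_nat[of 1 k f "n - d - k"] assms by simp
  ultimately show ?thesis by simp
qed

lemma sum_three_pieces:
  fixes x :: "nat \<Rightarrow> real"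
  assumes "k + d \<le> n"
    and "\<And>i. 1 \<le> i \<Longrightarrow> i \<le> k \<Longrightarrow> x i = m i"
    and "\<And>i. k < i \<Longrightarrow> i \<le> n - d \<Longrightarrow> x i = c"
    and "\<And>i. n - d < i \<Longrightarrow> i \<le> n \<Longrightarrow> x i = M i"
  shows "(\<Sum>i=1..n. x i) =
    (\<Sum>i=1..k. m i) + (real n - real k - real d) * c + (\<Sum>i=n-d+1..n. M i)"
proof -
  have "(\<Sum>i=1..k. x i) = (\<Sum>i=1..k. m i)"
    using assms(2) by (intro sum.cong) auto
  moreover have "(\<Sum>i=k+1..n-d. x i) = (\<Sum>i=k+1..n-d. c)"
    using assms(3) by (intro sum.cong) auto
  moreover have "(\<Sum>i=n-d+1..n. x i) = (\<Sum>i=n-d+1..n. M i)"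
    using assms(4) by (intro sum.cong) auto
  moreover have "(\<Sum>i=k+1..n-d. c) = (real n - real k - real d) * c"
    using assms(1) by (simp add: of_nat_diff algebra_simps)
  ultimately show ?thesis
    using sum_split3[OF assms(1), of x] by simp
qed

text \<open>Clearing the positive denominator: \<open>rho\<close> is the constant value on the
  middle block that brings the total to \<open>a\<close>.\<close>

lemma rho_eq_iff:
  assumes "k + d < n"
  shows "rho n m M a k d = c \<longleftrightarrow>
    a = (\<Sum>i=1..k. m i) + (real n - real k - real d) * c + (\<Sum>i=n-d+1..n. M i)"
proof -
  have "real n - real k - real d > 0" using assms by linarith
  then show ?thesis by (auto simp: rho_def field_simps)
qed

lemmas rho_eqD = rho_eq_iff[THEN iffD1, OF _ refl]

section \<open>Shrinking admissible pairs\<close>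

lemma weighted_mean_between:
  fixes N r r' u :: real
  assumes "N > 0" "(N + 1) * r' = N * r + u"
  shows "u \<le> r \<Longrightarrow> u \<le> r' \<and> r' \<le> r" "r \<le> u \<Longrightarrow> r \<le> r' \<and> r' \<le> u"
proof -
  have r': "r' = (N * r + u) / (N + 1)"
    using assms by (simp add: field_simps)
  have "u \<le> r \<Longrightarrow> N * u \<le> N * r" "r \<le> u \<Longrightarrow> N * r \<le> N * u"
    using assms(1) by simp_all
  then show "u \<le> r \<Longrightarrow> u \<le> r' \<and> r' \<le> r" "r \<le> u \<Longrightarrow> r \<le> r' \<and> r' \<le> u"
    using assms(1) unfolding r' by (auto simp: field_simps)
qed

text \<open>The index \<open>k + 1\<close> joins the middle block, so the new \<open>rho\<close> is
  the mean of \<open>?N\<close> copies of the old one and one copy of \<open>m (Suc k)\<close>. It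
  lies between the two, and the old \<open>rho\<close> is at most \<open>M (n - d)\<close>.\<close>

lemma admissible_drop_lower:
  assumes adm: "admissible n m M a (Suc k) d" and "m (Suc k) \<le> rho n m M a (Suc k) d"
  shows "admissible n m M a k d"
proof -
  have lt: "Suc k + d < n" using adm by (simp add: admissible_def)
  let ?N = "real n - real (Suc k) - real d"
  have "(?N + 1) * rho n m M a k d = ?N * rho n m M a (Suc k) d + m (Suc k)"
    using rho_eqD[of k d n a m M] rho_eqD[OF lt, of a m M] lt by (simp add: algebra_simps)
  moreover have "?N > 0" using lt by linarith
  ultimately show ?thesis
    using weighted_mean_between(1)[of ?N] assms by (fastforce simp: admissible_def)
qed

text \<open>Symmetrically, the index \<open>n - d\<close> joins the middle block and the new
  \<open>rho\<close> lies between the old one and \<open>M (n - d)\<close>.\<close>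

lemma admissible_drop_upper:
  assumes adm: "admissible n m M a k (Suc d)" and "rho n m M a k (Suc d) \<le> M (n - d)"
  shows "admissible n m M a k d"
proof -
  have lt: "k + Suc d < n" using adm by (simp add: admissible_def)
  let ?N = "real n - real k - real (Suc d)"
  have "{n - d..n} = insert (n - d) {n - d + 1..n}" using lt by auto
  moreover have "n - Suc d + 1 = n - d" using lt by linarith
  ultimately have "(\<Sum>i=n - Suc d + 1..n. M i) = M (n - d) + (\<Sum>i=n - d + 1..n. M i)"
    by simp
  then have "(?N + 1) * rho n m M a k d = ?N * rho n m M a k (Suc d) + M (n - d)"
    using rho_eqD[of k d n a m M] rho_eqD[OF lt, of a m M] lt by (simp add: algebra_simps)
  moreover have "?N > 0" using lt by linarith
  ultimately show ?thesis
    using weighted_mean_between(2)[of ?N] assms by (fastforce simp: admissible_def)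
qed

lemma smallest_admissible_rho_le:
  assumes "smallest_admissible n m M a k d" "k \<ge> 1"
  shows "rho n m M a k d \<le> m k"
proof (rule ccontr)
  assume "\<not> ?thesis"
  moreover obtain l where "k = Suc l" using assms(2) by (cases k) auto
  ultimately show False
    using assms(1) admissible_drop_lower[of n m M a l d]
    by (force simp: smallest_admissible_def)
qed

lemma smallest_admissible_le_rho:
  assumes "smallest_admissible n m M a k d" "d \<ge> 1"
  shows "M (n - d + 1) \<le> rho n m M a k d"
proof (rule ccontr)
  assume *: "\<not> ?thesis"
  obtain e where e: "d = Suc e" using assms(2) by (cases d) auto
  have "k + d < n" using assms(1) by (simp add: smallest_admissible_def admissible_def)
  then have "n - d + 1 = n - e" using e by linarith
  with * e show False
    using assms(1) admissible_drop_upper[of n m M a k e]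
    by (force simp: smallest_admissible_def)
qed

text \<open>A pair with least sum is minimal: a componentwise smaller pair of no smaller sum equals
  it.\<close>

lemma ex_smallest_admissible:
  assumes "admissible n m M a k d"
  shows "\<exists>k d. smallest_admissible n m M a k d"
proof -
  obtain p where p: "admissible n m M a (fst p) (snd p)"
    "\<And>q. admissible n m M a (fst q) (snd q) \<Longrightarrow> fst p + snd p \<le> fst q + snd q"
    using ex_has_least_nat[of "\<lambda>p. admissible n m M a (fst p) (snd p)" "(k, d)"
        "\<lambda>p. fst p + snd p"] assms by auto
  have "smallest_admissible n m M a (fst p) (snd p)"
    unfolding smallest_admissible_def using p(1) p(2)[of "(_, _)"] by fastforce
  then show ?thesis by blast
qed

section \<open>Existence of an admissible pair\<close>

lemma ex_level:
  assumes "n \<ge> 1" "antimono_on {1..n} m" "antimono_on {1..n} M"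
    and "\<forall>i\<in>{1..n}. m i \<le> M i"
    and "(\<Sum>i=1..n. m i) \<le> a" "a \<le> (\<Sum>i=1..n. M i)"
  obtains c where "m n \<le> c" "c \<le> M 1" "(\<Sum>i=1..n. trunc_level m M c i) = a"
proof -
  have anti: "m n \<le> m i" "M i \<le> M 1" if "i \<in> {1..n}" for i
    using that assms(1-3) by (auto simp: monotone_on_def)
  \<comment> \<open>The truncation is \<open>m\<close> at level \<open>m n\<close> and
    \<open>M\<close> at level \<open>M 1\<close>, so \<open>a\<close> lies between the values of a
    continuous function at these levels.\<close>
  have "(\<Sum>i=1..n. trunc_level m M (m n) i) = (\<Sum>i=1..n. m i)"
    using anti(1) by (intro sum.cong) (auto simp: trunc_level_def max.absorb1 min.coboundedI1)
  moreover have "(\<Sum>i=1..n. trunc_level m M (M 1) i) = (\<Sum>i=1..n. M i)"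
    using anti(2) assms(4) by (intro sum.cong) (fastforce simp: trunc_level_def max_def min_def)+
  moreover have "m n \<le> M 1" using anti(1)[of 1] assms(1,4) by force
  moreover have "continuous_on {m n..M 1} (\<lambda>c. \<Sum>i=1..n. trunc_level m M c i)"
    unfolding trunc_level_def by (intro continuous_intros)
  ultimately show thesis
    using IVT'[of "\<lambda>c. \<Sum>i=1..n. trunc_level m M c i" "m n" a "M 1"] assms(5,6) that by auto
qed

lemma ex_admissible:
  assumes n: "n \<ge> 1" and m: "antimono_on {1..n} m" and M: "antimono_on {1..n} M"
    and mM: "\<forall>i\<in>{1..n}. m i \<le> M i"
    and a: "(\<Sum>i=1..n. m i) \<le> a" "a \<le> (\<Sum>i=1..n. M i)"
  shows "\<exists>k d. admissible n m M a k d"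
proof -
  obtain c where c: "m n \<le> c" "c \<le> M 1" and sum: "(\<Sum>i=1..n. trunc_level m M c i) = a"
    by (rule ex_level[OF assms])
  \<comment> \<open>As \<open>m\<close> and \<open>M\<close> decrease, \<open>k + 1\<close> is the
    first index with \<open>m i \<le> c\<close> and \<open>n - d\<close> the last with
    \<open>c \<le> M i\<close>. Both minima exist and are at most \<open>n - 1\<close>, because
    \<open>m n \<le> c\<close> and \<open>c \<le> M 1\<close>.\<close>
  define k where "k = (LEAST k. m (k + 1) \<le> c)"
  define d where "d = (LEAST d. c \<le> M (n - d))"
  have k1: "m (n - 1 + 1) \<le> c" and d1: "c \<le> M (n - (n - 1))" using c n by auto
  have kd: "m (k + 1) \<le> c" "k \<le> n - 1" "c \<le> M (n - d)" "d \<le> n - 1"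
    using LeastI[of "\<lambda>k. m (k + 1) \<le> c", OF k1] Least_le[of "\<lambda>k. m (k + 1) \<le> c", OF k1]
      LeastI[of "\<lambda>d. c \<le> M (n - d)", OF d1] Least_le[of "\<lambda>d. c \<le> M (n - d)", OF d1]
    unfolding k_def d_def by simp_all
  have low: "c < m i" if "1 \<le> i" "i \<le> k" for i
    using not_less_Least[of "i - 1" "\<lambda>k. m (k + 1) \<le> c", folded k_def] that by (cases i) auto
  have up: "M i < c" if "n - d < i" "i \<le> n" for i
    using not_less_Least[of "n - i" "\<lambda>d. c \<le> M (n - d)", folded d_def] that by fastforce
  \<comment> \<open>If the outer blocks overlapped, the index \<open>n - d + 1\<close> would satisfy
    \<open>M i < c < m i\<close>.\<close>
  have "k + d \<le> n"
  proof (rule ccontr)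
    assume "\<not> k + d \<le> n"
    then have "n - d + 1 \<le> k" "n - d + 1 \<le> n" "n - d < n - d + 1" using kd n by linarith+
    with low[of "n - d + 1"] up[of "n - d + 1"] mM show False by force
  qed
  have mid: "m i \<le> c \<and> c \<le> M i" if "k < i" "i \<le> n - d" for i
  proof -
    have "m i \<le> m (k + 1)" "M (n - d) \<le> M i"
      using that kd n m M by (auto simp: monotone_on_def)
    with kd show ?thesis by linarith
  qed
  have "trunc_level m M c i = m i" if "1 \<le> i" "i \<le> k" for i
    using low[OF that] by (simp add: trunc_level_def)
  moreover have "trunc_level m M c i = c" if "k < i" "i \<le> n - d" for i
    using mid[OF that] by (simp add: trunc_level_def)
  moreover have "trunc_level m M c i = M i" if "n - d < i" "i \<le> n" for i
    using up[OF that] mM that by (simp add: trunc_level_def)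
  ultimately have eq: "a = (\<Sum>i=1..k. m i) + (real n - real k - real d) * c + (\<Sum>i=n-d+1..n. M i)"
    using sum_three_pieces[OF \<open>k + d \<le> n\<close>, of "trunc_level m M c" m c M] sum by simp
  show ?thesis
  proof (cases "k + d < n")
    case True
    then have "rho n m M a k d = c" using eq rho_eq_iff by blast
    with True kd show ?thesis by (auto simp: admissible_def)
  next
    case False
    \<comment> \<open>No component is at the level \<open>c\<close>, which may then be lowered to \<open>M (k + 1)\<close>.\<close>
    then have nkd: "n = k + d" using \<open>k + d \<le> n\<close> by simp
    then obtain e where e: "d = Suc e" using kd n by (cases d) auto
    \<comment> \<open>With \<open>e\<close> in place of \<open>d\<close>, the middle block is the
      single index \<open>k + 1\<close>, which keeps the value \<open>M (k + 1)\<close> it had in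
      the upper block.\<close>
    have "{k + 1..n} = insert (k + 1) {k + 2..n}" using nkd e by auto
    then have "(\<Sum>i=k+1..n. M i) = M (k + 1) + (\<Sum>i=k+2..n. M i)" by simp
    moreover have "n - d = k" "n - e = k + 1" using nkd e by auto
    ultimately have "rho n m M a k e = M (k + 1)"
      using eq nkd e rho_eq_iff[of k e n m M a "M (k + 1)"] by (simp add: algebra_simps)
    moreover have "m (k + 1) \<le> M (k + 1)" using mM nkd e by auto
    ultimately have "admissible n m M a k e"
      using nkd e \<open>n - e = k + 1\<close> by (simp add: admissible_def)
    then show ?thesis by blast
  qed
qed

section \<open>Identification of \<open>x_star\<close> with a truncation\<close>

lemma x_star_eq_trunc_level:
  assumes m: "antimono_on {1..n} m" and M: "antimono_on {1..n} M"
    and mM: "\<forall>i\<in>{1..n}. m i \<le> M i"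
    and sm: "smallest_admissible n m M a k d" and i: "i \<in> {1..n}"
  shows "x_star n m M a k d i = trunc_level m M (rho n m M a k d) i"
proof -
  let ?r = "rho n m M a k d"
  have adm: "k + d < n" "m (k + 1) \<le> ?r" "?r \<le> M (n - d)"
    using sm by (auto simp: smallest_admissible_def admissible_def)
  \<comment> \<open>Admissibility settles the middle block; on the outer blocks, monotonicity
    extends the inequalities at \<open>k\<close> and \<open>n - d + 1\<close> that minimality
    provides.\<close>
  consider "i \<le> k" | "k < i" "i \<le> n - d" | "n - d < i" by linarith
  then show ?thesis
  proof cases
    case 1
    then have "m k \<le> m i" using i m adm(1) by (auto simp: monotone_on_def)
    moreover have "?r \<le> m k" using smallest_admissible_rho_le[OF sm] 1 i by auto
    ultimately show ?thesis using 1 i by (simp add: x_star_def trunc_level_def)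
  next
    case 2
    then have "m i \<le> m (k + 1)" "M (n - d) \<le> M i"
      using i m M adm(1) by (auto simp: monotone_on_def)
    with 2 adm show ?thesis using i by (simp add: x_star_def trunc_level_def)
  next
    case 3
    then have "M i \<le> M (n - d + 1)" using i M by (auto simp: monotone_on_def)
    moreover have "M (n - d + 1) \<le> ?r" using smallest_admissible_le_rho[OF sm] 3 i by auto
    moreover have "\<not> i \<le> k" using 3 adm(1) by linarith
    ultimately show ?thesis using 3 i mM by (simp add: x_star_def trunc_level_def)
  qed
qed

lemma sum_x_star:
  assumes "k + d < n"
  shows "(\<Sum>i=1..n. x_star n m M a k d i) = a"
proof -
  have "(\<Sum>i=1..n. x_star n m M a k d i) = (\<Sum>i=1..k. m i)
      + (real n - real k - real d) * rho n m M a k d + (\<Sum>i=n-d+1..n. M i)"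
    using assms by (intro sum_three_pieces) (auto simp: x_star_def)
  then show ?thesis using rho_eqD[OF assms, of a m M] by simp
qed

section \<open>Truncations and majorization\<close>

lemma antimono_on_trunc_level:
  assumes "antimono_on A m" "antimono_on A M"
  shows "antimono_on A (trunc_level m M c)"
  using assms unfolding monotone_on_def trunc_level_def by (meson max.mono min.mono order_refl)

lemma trunc_level_partial_sum_le:
  assumes y: "antimono_on {1..n} y" "\<forall>i\<in>{1..n}. m i \<le> y i \<and> y i \<le> M i"
    and eq: "(\<Sum>i=1..n. trunc_level m M c i) = (\<Sum>i=1..n. y i)" and j: "j \<in> {1..n}"
  shows "(\<Sum>i=1..j. trunc_level m M c i) \<le> (\<Sum>i=1..j. y i)"
\<comment> \<open>The position of \<open>c\<close> relative to \<open>y j\<close> decides which side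
  is compared: \<open>y i \<ge> y j \<ge> c\<close> for \<open>i \<le> j\<close>, or
  \<open>y i \<le> y j < c\<close> for \<open>i > j\<close>.\<close>
proof (cases "c \<le> y j")
  case True
  show ?thesis
  proof (rule sum_mono)
    fix i assume "i \<in> {1..j}"
    then have "y j \<le> y i" "m i \<le> y i" using y j by (auto simp: monotone_on_def)
    with True show "trunc_level m M c i \<le> y i" by (simp add: trunc_level_def)
  qed
next
  case False
  have "(\<Sum>i=j+1..n. y i) \<le> (\<Sum>i=j+1..n. trunc_level m M c i)"
  proof (rule sum_mono)
    fix i assume "i \<in> {j+1..n}"
    then have "y i \<le> y j" "y i \<le> M i" using y j by (auto simp: monotone_on_def)
    with False show "y i \<le> trunc_level m M c i" by (simp add: trunc_level_def)
  qed
  \<comment> \<open>Since the totals agree, the inequality between the tails reverses for the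
    initial sums.\<close>
  moreover have "(\<Sum>i=1..n. f i) = (\<Sum>i=1..j. f i) + (\<Sum>i=j+1..n. f i)" for f :: "nat \<Rightarrow> real"
    using sum.ub_add_nat[of 1 j f "n - j"] j by simp
  ultimately show ?thesis using eq by (smt (verit))
qed

theorem theorem8:
  fixes n :: nat and m M :: "nat \<Rightarrow> real" and a :: real
  assumes "n \<ge> 1"
    and "antimono_on {1..n} m" and "antimono_on {1..n} M"
    and "\<forall>i\<in>{1..n}. 0 \<le> m i \<and> m i \<le> M i"
    and "a > 0"
    and "(\<Sum>i=1..n. m i) \<le> a" and "a \<le> (\<Sum>i=1..n. M i)"
  shows "(\<exists>k d. smallest_admissible n m M a k d) \<and>
         (\<forall>k d. smallest_admissible n m M a k d \<longrightarrow>
            minimal_element n (S_set n m M a) (x_star n m M a k d))"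
proof (intro conjI allI impI)
  have mM: "\<forall>i\<in>{1..n}. m i \<le> M i" using assms(4) by blast
  show "\<exists>k d. smallest_admissible n m M a k d"
    using ex_admissible[OF assms(1-3) mM assms(6,7)] ex_smallest_admissible by blast
  fix k d assume sm: "smallest_admissible n m M a k d"
  let ?x = "x_star n m M a k d" and ?t = "trunc_level m M (rho n m M a k d)"
  \<comment> \<open>The bounds, the monotonicity and the partial sum inequalities are all
    transferred from the truncation along this equality.\<close>
  have x: "?x i = ?t i" if "i \<in> {1..n}" for i
    by (rule x_star_eq_trunc_level[OF assms(2,3) mM sm that])
  have sum: "(\<Sum>i=1..n. ?x i) = a"
    using sm by (intro sum_x_star) (simp add: smallest_admissible_def admissible_def)
  have sum_eq: "(\<Sum>i=1..j. ?x i) = (\<Sum>i=1..j. ?t i)" if "j \<le> n" for j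
    using x that by (intro sum.cong) auto
  have bounds: "m i \<le> ?x i \<and> ?x i \<le> M i" if "i \<in> {1..n}" for i
    using x[OF that] mM that by (simp add: trunc_level_def)
  have "antimono_on {1..n} ?x"
    using antimono_on_trunc_level[OF assms(2,3)] x by (simp add: monotone_on_def)
  moreover have "0 \<le> ?x n" using bounds[of n] assms(1,4) by force
  moreover have "?x \<in> extensional {1..n}" by (simp add: x_star_def)
  ultimately have "?x \<in> S_set n m M a" using sum bounds by (simp add: S_set_def)
  moreover have "majorized n ?x y" if "y \<in> S_set n m M a" for y
  proof -
    have y: "antimono_on {1..n} y" "\<forall>i\<in>{1..n}. m i \<le> y i \<and> y i \<le> M i" "(\<Sum>i=1..n. y i) = a"
      using that by (auto simp: S_set_def)
    have "(\<Sum>i=1..n. ?t i) = (\<Sum>i=1..n. y i)" using sum sum_eq[of n] y(3) by simp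
    then have "(\<Sum>i=1..j. ?x i) \<le> (\<Sum>i=1..j. y i)" if "j \<in> {1..n}" for j
      using trunc_level_partial_sum_le[OF y(1,2) _ that] sum_eq[of j] that by simp
    then show ?thesis using sum y(3) by (auto simp: majorized_def)
  qed
  ultimately show "minimal_element n (S_set n m M a) ?x" by (simp add: minimal_element_def)
qed

end
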